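(* Let $n,t\in\mathbb N$, let $G\subseteq\operatorname{Sym}\mathbb R[\bar X]^{t\times t}$ be a (possibly infinite) set of symmetric matrix polynomials, and suppose that the quadratic module $M_G$ is archimedean. Then for each pure state $L$ on $(\operatorname{Sym}\mathbb R[\bar X]^{t\times t},M_G)$ there exist $x\in S_G$ and a unit vector $v\in\mathbb R^t$ such that $$L(p)=\langle p(x)v,v\rangle\qquad\text{for all }p\in\operatorname{Sym}\mathbb R[\bar X]^{t\times t}.$$
   Context: $\mathbb N=\{1,2,\dots\}$. $\mathbb R[\bar X]$ is the (commutative) polynomial ring in $n$ variables $\bar X=(X_1,\dots,X_n)$. $\mathbb R[\bar X]^{t\times t}$ is the ring of $t\times t$ matrices over $\mathbb R[\bar X]$ with involution $*$ the transpose, and $\operatorname{Sym}\mathbb R[\bar X]^{t\times t}=\{p\in\mathbb R[\bar X]^{t\times t}\mid p=p^*\}$. $1$ denotes the identity matrix, and scalars are identified with scalar multiples of it. $\langle\cdot,\cdot\rangle$ is the standard inner product on $\mathbb R^t$. For a symmetric real matrix $A$, $A\succeq0$ means $A$ is positive semidefinite. For $G\subseteq\operatorname{Sym}\mathbb R[\bar X]^{t\times t}$: $S_G=\{x\in\mathbb R^n\mid g(x)\succeq0\text{ for all }g\in G\}$, and $M_G=\{\sum_{i=1}^Np_i^*g_ip_i\mid N\in\mathbb N,\ g_i\in\{1\}\cup G,\ p_i\in\mathbb R[\bar X]^{t\times t}\}$ (the quadratic module generated by $G$). $M_G$ is archimedean if for every $a\in\mathbb R[\bar X]^{t\times t}$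 there is $N\in\mathbb N$ with $N-a^*a\in M_G$. A state on $(\operatorname{Sym}\mathbb R[\bar X]^{t\times t},M_G)$ is an $\mathbb R$-linear form $L:\operatorname{Sym}\mathbb R[\bar X]^{t\times t}\to\mathbb R$ with $L(M_G)\subseteq\mathbb R_{\ge0}$ and $L(1)=1$. A state is pure if it is an extreme point of the convex set of all states, i.e. it is not a proper convex combination of two states other than itself. *)

theory Defs
  imports "HOL-Analysis.Analysis" "HOL-Analysis.Finite_Function_Topology"
begin

text \<open>
  Real polynomials in the variables indexed by the finite type \<open>'n\<close> are finitely supported maps
  from exponent vectors \<open>'n \<Rightarrow>\<^sub>0 nat\<close> to coefficients; the product of the type class instance
  is the convolution product. On matrices over this ring, \<open>*\<^sub>R\<close> acts entrywise and coefficientwise,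
  and the identity is \<open>mat 1\<close> (the constant \<open>1\<close> of the vector type is not the identity matrix).
\<close>

type_synonym 'n rpoly = "('n \<Rightarrow>\<^sub>0 nat) \<Rightarrow>\<^sub>0 real"

type_synonym ('n, 't) matpoly = "('n rpoly) ^ 't ^ 't"

definition poly_eval :: "'n::finite rpoly \<Rightarrow> real ^ 'n \<Rightarrow> real" where
  "poly_eval p x =
     (\<Sum>m\<in>Poly_Mapping.keys p. Poly_Mapping.lookup p m * (\<Prod>i\<in>UNIV. (x $ i) ^ Poly_Mapping.lookup m i))"

definition mat_eval :: "('n::finite, 't::finite) matpoly \<Rightarrow> real ^ 'n \<Rightarrow> real ^ 't ^ 't" where
  "mat_eval p x = (\<chi> i j. poly_eval (p $ i $ j) x)"

definition Sym :: "('n::finite, 't::finite) matpoly set" where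
  "Sym = {p. p = transpose p}"

definition psd :: "real ^ 't ^ 't::finite \<Rightarrow> bool" where
  "psd A \<longleftrightarrow> transpose A = A \<and> (\<forall>v. 0 \<le> (A *v v) \<bullet> v)"

definition psd_locus :: "('n::finite, 't::finite) matpoly set \<Rightarrow> (real ^ 'n) set" where
  "psd_locus G = {x. \<forall>g\<in>G. psd (mat_eval g x)}"

definition quadratic_module :: "('n::finite, 't::finite) matpoly set \<Rightarrow> ('n, 't) matpoly set" where
  "quadratic_module G =
     {(\<Sum>i=1..N. transpose (p i) ** g i ** p i) | (N::nat) g p.
        1 \<le> N \<and> (\<forall>i\<in>{1..N}. g i \<in> {mat 1} \<union> G)}"

definition archimedean :: "('n::finite, 't::finite) matpoly set \<Rightarrow> bool" where
  "archimedean M \<longleftrightarrow> (\<forall>a :: ('n, 't) matpoly. \<exists>N::nat. 1 \<le> N \<and> mat (of_nat N) - transpose a ** a \<in> M)"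

text \<open>
  Linear forms on \<open>Sym\<close> are represented by functions on all matrix polynomials of which only
  the restriction to \<open>Sym\<close> matters; accordingly, states are compared on \<open>Sym\<close> only.
\<close>

definition is_state ::
    "('n::finite, 't::finite) matpoly set \<Rightarrow> (('n, 't) matpoly \<Rightarrow> real) \<Rightarrow> bool" where
  "is_state M L \<longleftrightarrow>
     (\<forall>p\<in>Sym. \<forall>q\<in>Sym. L (p + q) = L p + L q) \<and>
     (\<forall>c::real. \<forall>p\<in>Sym. L (c *\<^sub>R p) = c * L p) \<and>
     (\<forall>p\<in>M. 0 \<le> L p) \<and>
     L (mat 1) = 1"

definition pure_state ::
    "('n::finite, 't::finite) matpoly set \<Rightarrow> (('n, 't) matpoly \<Rightarrow> real) \<Rightarrow> bool" where
  "pure_state M L \<longleftrightarrow>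
     is_state M L \<and>
     (\<forall>L1 L2. \<forall>u::real.
        is_state M L1 \<and> is_state M L2 \<and> 0 < u \<and> u < 1 \<and>
        (\<forall>p\<in>Sym. L p = (1 - u) * L1 p + u * L2 p)
        \<longrightarrow> (\<forall>p\<in>Sym. L1 p = L p) \<and> (\<forall>p\<in>Sym. L2 p = L p))"

end

theory Submission
  imports Defs
begin

text \<open>
  For a scalar polynomial \<open>q\<close> the form \<open>f \<mapsto> L(q\<^sup>2 f)\<close> is nonnegative on \<open>M\<^sub>G\<close> and, by the archimedean
  property, dominated by a multiple of \<open>L\<close>. Purity forces it to be proportional to \<open>L\<close>, so
  \<open>L(q f) = L(q) L(f)\<close> for all \<open>q\<close>. Hence \<open>L\<close> is evaluation at a point \<open>x\<close> on scalars, and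
  \<open>L(f) = tr(f(x) B)\<close> for a symmetric real matrix \<open>B\<close>. Nonnegativity on \<open>M\<^sub>G\<close> shows that \<open>B\<close> is
  positive semidefinite and that \<open>x \<in> S\<^sub>G\<close>. Splitting a rank-one piece off \<open>B\<close> writes \<open>L\<close> as a convex
  combination of states at \<open>x\<close>; by purity \<open>L\<close> is the vector state belonging to that piece.
\<close>

subsection \<open>Evaluation of polynomials\<close>

lemma scaleR_poly_mapping_eq_mult: "c *\<^sub>R (p :: 'n rpoly) = Poly_Mapping.single 0 c * p"
proof -
  have "c *\<^sub>R p = Poly_Mapping.map ((*) c) p"
    by (intro poly_mapping_eqI) (simp add: scaleR_poly_mapping_def Poly_Mapping.map.rep_eq when_def)
  then show ?thesis by (simp add: mult_map_scale_conv_mult)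
qed

lemma poly_mapping_sum_singles:
  "p = (\<Sum>m\<in>Poly_Mapping.keys p. Poly_Mapping.single m (Poly_Mapping.lookup p m))"
  by (intro poly_mapping_eqI) (simp add: lookup_sum lookup_single when_def in_keys_iff)

lemma poly_eval_superset:
  assumes "finite S" "Poly_Mapping.keys p \<subseteq> S"
  shows "poly_eval p x = (\<Sum>m\<in>S. Poly_Mapping.lookup p m * (\<Prod>i\<in>UNIV. (x $ i) ^ Poly_Mapping.lookup m i))"
  unfolding poly_eval_def using assms by (intro sum.mono_neutral_left) (auto simp: in_keys_iff)

lemma poly_eval_0 [simp]: "poly_eval 0 x = 0"
  by (simp add: poly_eval_def)

lemma poly_eval_add: "poly_eval (p + q) x = poly_eval p x + poly_eval q x"
proof -
  let ?S = "Poly_Mapping.keys p \<union> Poly_Mapping.keys q"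
  have "Poly_Mapping.keys (p + q) \<subseteq> ?S" by (rule keys_add)
  then show ?thesis
    by (simp add: poly_eval_superset[of ?S] lookup_add distrib_right sum.distrib)
qed

lemma poly_eval_sum: "poly_eval (sum f S) x = (\<Sum>i\<in>S. poly_eval (f i) x)"
  by (induction S rule: infinite_finite_induct) (auto simp: poly_eval_add)

lemma poly_eval_single:
  "poly_eval (Poly_Mapping.single m c) x = c * (\<Prod>i\<in>UNIV. (x $ i) ^ Poly_Mapping.lookup m i)"
  by (simp add: poly_eval_superset[of "{m}"])

lemma poly_eval_mult: "poly_eval (p * q) x = poly_eval p x * poly_eval q x"
proof -
  have single: "poly_eval (Poly_Mapping.single k a * Poly_Mapping.single l b) x =
      poly_eval (Poly_Mapping.single k a) x * poly_eval (Poly_Mapping.single l b) x" for k l a b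
    by (simp add: mult_single poly_eval_single lookup_add power_add prod.distrib)
  have "poly_eval (p * q) x =
      (\<Sum>k\<in>Poly_Mapping.keys p. \<Sum>l\<in>Poly_Mapping.keys q.
        poly_eval (Poly_Mapping.single k (Poly_Mapping.lookup p k)) x *
        poly_eval (Poly_Mapping.single l (Poly_Mapping.lookup q l)) x)"
    by (subst (1) poly_mapping_sum_singles[of p], subst (1) poly_mapping_sum_singles[of q])
       (simp add: sum_product poly_eval_sum single)
  also have "\<dots> = poly_eval p x * poly_eval q x"
    by (simp add: poly_eval_single sum_product poly_eval_def[of p] poly_eval_def[of q])
  finally show ?thesis .
qed

lemma poly_eval_scaleR: "poly_eval (c *\<^sub>R p) x = c * poly_eval p x"
  by (simp add: scaleR_poly_mapping_eq_mult poly_eval_mult poly_eval_single)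

lemma poly_eval_1 [simp]: "poly_eval 1 x = 1"
  using poly_eval_single[of 0 1 x] by simp

text \<open>Every polynomial is built from constants and variables by sums and products, and
  \<open>h\<close> respects all of these. The condition on constants makes \<open>h\<close>
  real-linear; the point collects the images of the variables.\<close>

lemma ring_hom_eq_poly_eval:
  fixes h :: "'n::finite rpoly \<Rightarrow> real"
  assumes add: "\<And>p q. h (p + q) = h p + h q"
    and mult: "\<And>p q. h (p * q) = h p * h q"
    and const: "\<And>c. h (Poly_Mapping.single 0 c) = c"
  shows "h p = poly_eval p (\<chi> i. h (Poly_Mapping.single (Poly_Mapping.single i 1) 1))"
proof -
  define X where "X i = (Poly_Mapping.single (Poly_Mapping.single i 1) 1 :: 'n rpoly)" for i
  define x :: "real ^ 'n" where "x = (\<chi> i. h (X i))"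
  have h0: "h 0 = 0" and h1: "h 1 = 1" using const[of 0] const[of 1] by simp_all
  have sum: "h (sum f S) = (\<Sum>i\<in>S. h (f i))" for f :: "_ \<Rightarrow> 'n rpoly" and S :: "('n \<Rightarrow>\<^sub>0 nat) set"
    by (induction S rule: infinite_finite_induct) (auto simp: add h0)
  have var: "h (Poly_Mapping.single (Poly_Mapping.single i k) 1) = h (X i) ^ k" for i k
  proof (induction k)
    case 0 then show ?case by (simp add: h1)
  next
    case (Suc k)
    have "Poly_Mapping.single (Poly_Mapping.single i (Suc k)) 1 =
        X i * Poly_Mapping.single (Poly_Mapping.single i k) 1"
      by (simp add: X_def mult_single single_add[symmetric])
    then show ?case by (simp add: mult Suc)
  qed
  have monom: "h (Poly_Mapping.single (\<Sum>i\<in>S. Poly_Mapping.single i (k i)) 1) = (\<Prod>i\<in>S. h (X i) ^ k i)"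
    if "finite S" for S k
    using that
  proof (induction S)
    case empty then show ?case by (simp add: h1)
  next
    case (insert i S)
    have "Poly_Mapping.single (\<Sum>i\<in>insert i S. Poly_Mapping.single i (k i)) 1 =
      Poly_Mapping.single (Poly_Mapping.single i (k i)) (1::real) *
      Poly_Mapping.single (\<Sum>i\<in>S. Poly_Mapping.single i (k i)) 1"
      using insert by (simp add: mult_single)
    then show ?case using insert by (simp add: mult var)
  qed
  \<comment> \<open>Splitting an exponent vector along the coordinate axes brings every monomial
    into the form treated by \<open>monom\<close>.\<close>
  have exps: "m = (\<Sum>i\<in>UNIV. Poly_Mapping.single i (Poly_Mapping.lookup m i))" for m :: "'n \<Rightarrow>\<^sub>0 nat"
    by (intro poly_mapping_eqI) (simp add: lookup_sum lookup_single when_def)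
  have "h (Poly_Mapping.single m c) = poly_eval (Poly_Mapping.single m c) x" for m c
  proof -
    have "Poly_Mapping.single m c = Poly_Mapping.single 0 c * Poly_Mapping.single m 1"
      by (simp add: mult_single)
    then have "h (Poly_Mapping.single m c) = c * h (Poly_Mapping.single m 1)"
      by (simp add: mult const)
    also have "h (Poly_Mapping.single m 1) = (\<Prod>i\<in>UNIV. h (X i) ^ Poly_Mapping.lookup m i)"
      by (subst exps) (rule monom, simp)
    finally show ?thesis by (simp add: poly_eval_single x_def)
  qed
  then have "h p = poly_eval p x"
    by (subst (1 2) poly_mapping_sum_singles[of p]) (simp only: sum poly_eval_sum)
  then show ?thesis by (simp add: x_def X_def)
qed

subsection \<open>Positive semidefinite matrices\<close>

definition outer :: "real ^ 't::finite \<Rightarrow> real ^ 't \<Rightarrow> real ^ 't ^ 't" where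
  "outer v w = (\<chi> i j. v $ i * w $ j)"

lemma inner_outer: "A \<bullet> outer v w = (A *v w) \<bullet> v"
  by (simp add: inner_vec_def outer_def matrix_vector_mult_def sum_distrib_left sum_distrib_right
      mult_ac)

lemma transpose_add: "transpose (A + B) = transpose A + transpose B"
  by (simp add: transpose_def vec_eq_iff)

lemma transpose_diff: "transpose (A - B) = transpose A - transpose B"
  by (simp add: transpose_def vec_eq_iff)

lemma matrix_add_rdistrib: "(A + B) ** C = A ** C + B ** C"
  by (simp add: matrix_matrix_mult_def vec_eq_iff distrib_right sum.distrib)

lemma quadratic_form_discriminant:
  fixes a b c :: real
  assumes form: "\<And>s t. 0 \<le> s\<^sup>2 * a + 2 * s * t * b + t\<^sup>2 * c"
  shows "b\<^sup>2 \<le> a * c"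
proof -
  have "0 \<le> a" using form[of 1 0] by simp
  show ?thesis
  proof (cases "a = 0")
    case True
    have "b = 0"
    proof (rule ccontr)
      assume "b \<noteq> 0"
      \<comment> \<open>With \<open>a = 0\<close> the form is affine in \<open>s\<close> at
        \<open>t = 1\<close>; this \<open>s\<close> gives it the value -1.\<close>
      then show False using form[of "- (c + 1) / (2 * b)" 1] True by (simp add: field_simps)
    qed
    then show ?thesis using True by simp
  next
    case False
    \<comment> \<open>At \<open>t = 1\<close> the minimum over \<open>s\<close> is attained here and
      equals \<open>c - b^2 / a\<close>.\<close>
    then show ?thesis using form[of "- b / a" 1] \<open>0 \<le> a\<close>
      by (simp add: field_simps power2_eq_square)
  qed
qed

lemma psd_symmetric_inner: "psd A \<Longrightarrow> (A *v v) \<bullet> w = (A *v w) \<bullet> v"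
  unfolding psd_def by (metis dot_lmul_matrix inner_commute transpose_matrix_vector)

lemma psd_Cauchy_Schwarz:
  assumes "psd A"
  shows "((A *v v) \<bullet> w)\<^sup>2 \<le> ((A *v v) \<bullet> v) * ((A *v w) \<bullet> w)"
proof (rule quadratic_form_discriminant)
  fix s t :: real
  have "0 \<le> (A *v (s *\<^sub>R v + t *\<^sub>R w)) \<bullet> (s *\<^sub>R v + t *\<^sub>R w)"
    using assms by (simp add: psd_def)
  also have "\<dots> = s\<^sup>2 * ((A *v v) \<bullet> v) + 2 * s * t * ((A *v v) \<bullet> w) + t\<^sup>2 * ((A *v w) \<bullet> w)"
    by (simp add: matrix_vector_right_distrib matrix_vector_mult_scaleR inner_add
        psd_symmetric_inner[OF assms, of w v] power2_eq_square algebra_simps)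
  finally show "0 \<le> \<dots>" .
qed

lemma matrix_entry_eq_inner: "(A :: real ^ 't ^ 't::finite) $ i $ j = (A *v axis j 1) \<bullet> axis i 1"
  by (simp add: matrix_vector_mult_basis column_def inner_axis)

lemma psd_diag_nonneg: "psd A \<Longrightarrow> 0 \<le> A $ i $ i"
  by (simp add: psd_def matrix_entry_eq_inner)

lemma psd_diag_zero_imp_entry_zero:
  assumes "psd A" "A $ i $ i = 0"
  shows "A $ i $ j = 0" "A $ j $ i = 0"
  using psd_Cauchy_Schwarz[OF assms(1), of "axis i 1" "axis j 1"]
    psd_Cauchy_Schwarz[OF assms(1), of "axis j 1" "axis i 1"] assms(2)
  by (simp_all add: matrix_entry_eq_inner[symmetric])

text \<open>One step of the symmetric Gaussian elimination: a rank-one piece is split off so that the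
  \<open>i\<close>-th row and column of the remainder vanish.\<close>

lemma psd_deflate:
  assumes "psd A" "0 < A $ i $ i"
  shows "psd (A - (1 / A $ i $ i) *\<^sub>R outer (A *v axis i 1) (A *v axis i 1))"
  unfolding psd_def
proof (intro conjI allI)
  let ?b = "A *v axis i 1" and ?c = "A $ i $ i"
  show "transpose (A - (1 / ?c) *\<^sub>R outer ?b ?b) = A - (1 / ?c) *\<^sub>R outer ?b ?b"
    using assms(1) by (simp add: psd_def transpose_diff transpose_scalar)
      (simp add: transpose_def outer_def vec_eq_iff mult.commute)
  fix v
  have "outer ?b ?b *v v = (?b \<bullet> v) *\<^sub>R ?b"
    by (simp add: outer_def matrix_vector_mult_def vec_eq_iff inner_vec_def sum_distrib_right
      sum_distrib_left mult_ac)
  then have "((A - (1 / ?c) *\<^sub>R outer ?b ?b) *v v) \<bullet> v = (A *v v) \<bullet> v - (?b \<bullet> v)\<^sup>2 / ?c"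
    by (simp add: matrix_vector_mult_diff_rdistrib inner_diff_left power2_eq_square
      scaleR_matrix_vector_assoc[symmetric])
  moreover have "(?b \<bullet> v)\<^sup>2 \<le> ?c * ((A *v v) \<bullet> v)"
    using psd_Cauchy_Schwarz[OF assms(1), of "axis i 1" v] by (simp add: matrix_entry_eq_inner)
  ultimately show "0 \<le> ((A - (1 / ?c) *\<^sub>R outer ?b ?b) *v v) \<bullet> v"
    using assms(2) by (simp add: divide_le_eq mult.commute)
qed

text \<open>Repeated deflation of \<open>C\<close> peels off rank-one pieces
  \<open>outer b b\<close>, each pairing with \<open>A\<close> to
  \<open>(A *v b) \<bullet> b\<close>, which is nonnegative. The induction counts the nonzero
  diagonal entries of \<open>C\<close>, so no spectral decomposition enters.\<close>

lemma psd_inner_nonneg: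
  assumes "psd A" "psd C"
  shows "0 \<le> A \<bullet> C"
  using assms(2)
proof (induction "card {i. C $ i $ i \<noteq> 0}" arbitrary: C rule: less_induct)
  case less
  show ?case
  proof (cases "\<forall>i. C $ i $ i = 0")
    case True
    then have "C $ i $ j = 0" for i j using psd_diag_zero_imp_entry_zero(1)[OF less.prems] by blast
    then have "C = 0" unfolding vec_eq_iff by simp
    then show ?thesis by simp
  next
    case False
    then obtain i where i: "0 < C $ i $ i"
      using psd_diag_nonneg[OF less.prems] by (metis less_eq_real_def)
    let ?b = "C *v axis i 1" and ?c = "C $ i $ i"
    let ?D = "C - (1 / ?c) *\<^sub>R outer ?b ?b"
    have b: "?b $ j = C $ j $ i" for j
      by (simp add: matrix_vector_mult_basis column_def)
    have D: "?D $ j $ j = C $ j $ j - (C $ j $ i)\<^sup>2 / ?c" for j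
      by (simp add: outer_def b power2_eq_square)
    have "?D $ i $ i = 0" using i by (simp only: D) (simp add: power2_eq_square)
    \<comment> \<open>A zero diagonal entry has a zero row and column, so deflation leaves it zero;
      with the new zero at \<open>i\<close> the count drops strictly.\<close>
    moreover have "?D $ j $ j = 0" if "C $ j $ j = 0" for j
      using psd_diag_zero_imp_entry_zero[OF less.prems that] that by (simp only: D) simp
    ultimately have "{j. ?D $ j $ j \<noteq> 0} \<subset> {j. C $ j $ j \<noteq> 0}" using i by auto
    then have "card {j. ?D $ j $ j \<noteq> 0} < card {j. C $ j $ j \<noteq> 0}"
      by (intro psubset_card_mono) auto
    then have "0 \<le> A \<bullet> ?D" using less.hyps psd_deflate[OF less.prems i] by blast
    moreover have "0 \<le> A \<bullet> outer ?b ?b" using assms(1) by (simp add: inner_outer psd_def)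
    moreover have "A \<bullet> C = A \<bullet> ?D + A \<bullet> outer ?b ?b / ?c" by (simp add: inner_diff_right)
    ultimately show ?thesis using i by simp
  qed
qed

lemma psd_outer: "psd (outer v v)"
  unfolding psd_def
proof (intro conjI allI)
  show "transpose (outer v v) = outer v v"
    by (simp add: transpose_def outer_def vec_eq_iff mult.commute)
  fix w
  have "(outer v v *v w) \<bullet> w = (v \<bullet> w)\<^sup>2"
    by (simp add: outer_def matrix_vector_mult_def inner_vec_def power2_eq_square sum_product
      sum_distrib_right sum_distrib_left mult_ac)
  then show "0 \<le> (outer v v *v w) \<bullet> w" by simp
qed

lemma psd_0: "psd 0" and psd_mat_1: "psd (mat 1)"
  by (simp_all add: psd_def) (simp add: transpose_def vec_eq_iff)

lemma psd_add: "psd A \<Longrightarrow> psd B \<Longrightarrow> psd (A + B)"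
  by (simp add: psd_def transpose_add matrix_vector_mult_add_rdistrib inner_add_left)

lemma psd_scaleR: "psd A \<Longrightarrow> 0 \<le> c \<Longrightarrow> psd (c *\<^sub>R A)"
  by (simp add: psd_def transpose_scalar scaleR_matrix_vector_assoc[symmetric])

lemma psd_sum: "(\<And>i. i \<in> S \<Longrightarrow> psd (f i)) \<Longrightarrow> psd (sum f S)"
  by (induction S rule: infinite_finite_induct) (auto simp: psd_0 psd_add)

lemma psd_congruence:
  assumes "psd A"
  shows "psd (transpose P ** A ** P)"
  unfolding psd_def
proof (intro conjI allI)
  show "transpose (transpose P ** A ** P) = transpose P ** A ** P"
    using assms by (simp add: psd_def matrix_transpose_mul matrix_mul_assoc)
  fix v
  have "((transpose P ** A ** P) *v v) \<bullet> v = (A *v (P *v v)) \<bullet> (P *v v)"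
    by (simp add: matrix_vector_mul_assoc[symmetric] dot_lmul_matrix)
  then show "0 \<le> ((transpose P ** A ** P) *v v) \<bullet> v"
    using assms by (simp add: psd_def)
qed

lemma congruence_outer: "transpose (outer w u) ** A ** outer w u = ((A *v w) \<bullet> w) *\<^sub>R outer u u"
  by (simp add: vec_eq_iff matrix_matrix_mult_def transpose_def outer_def inner_vec_def
      matrix_vector_mult_def sum_distrib_left sum_distrib_right mult_ac)
     (intro allI, subst sum.swap, simp add: mult_ac)

subsection \<open>Quadratic modules of matrix polynomials\<close>

lemma mat_mult_component: "(mat q ** f) $ i $ j = q * f $ i $ j"
  by (simp add: matrix_matrix_mult_def mat_def if_distrib[of "\<lambda>z. z * _"] cong: if_cong)

lemma mult_mat_component: "(f ** mat q) $ i $ j = f $ i $ j * q"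
  by (simp add: matrix_matrix_mult_def mat_def if_distrib[of "\<lambda>z. _ * z"] cong: if_cong)

lemma mat_commute: "mat q ** f = f ** mat (q :: 'a :: comm_semiring_1)"
  by (simp add: vec_eq_iff mat_mult_component mult_mat_component mult.commute)

lemma mat_mult: "mat (p * q) = mat p ** mat q"
  by (simp add: vec_eq_iff mat_mult_component) (simp add: mat_def)

lemma mat_add: "mat (p + q) = mat p + mat (q :: 'a :: monoid_add)"
  by (simp add: vec_eq_iff mat_def)

lemma mat_single_mult:
  "mat (Poly_Mapping.single 0 c) ** f = c *\<^sub>R (f :: ('n::finite, 't::finite) matpoly)"
  by (simp add: vec_eq_iff mat_mult_component scaleR_poly_mapping_eq_mult)

lemma mat_single: "mat (Poly_Mapping.single 0 c) = c *\<^sub>R (mat 1 :: ('n::finite, 't::finite) matpoly)"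
  using mat_single_mult[of c "mat 1"] by simp

lemma mat_of_nat: "mat (of_nat N) = real N *\<^sub>R (mat 1 :: ('n::finite, 't::finite) matpoly)"
  by (simp add: mat_single[symmetric])

lemma sum_matrix_mult: "sum f S ** a = (\<Sum>i\<in>S. f i ** a)"
  by (simp add: vec_eq_iff matrix_matrix_mult_def sum_distrib_right) (intro allI, rule sum.swap)

lemma matrix_mult_sum_right: "a ** sum f S = (\<Sum>i\<in>S. a ** f i)"
  by (simp add: vec_eq_iff matrix_matrix_mult_def sum_distrib_left) (intro allI, rule sum.swap)

lemma transpose_sum: "transpose (sum f S) = (\<Sum>i\<in>S. transpose (f i))"
  by (simp add: vec_eq_iff transpose_def)

lemma SymI: "transpose p = p \<Longrightarrow> p \<in> Sym"
  and SymD: "p \<in> Sym \<Longrightarrow> transpose p = p"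
  by (simp_all add: Sym_def)

lemma Sym_mat [simp]: "mat q \<in> Sym"
  by (simp add: Sym_def)

lemma Sym_add [simp]: "p \<in> Sym \<Longrightarrow> q \<in> Sym \<Longrightarrow> p + q \<in> Sym"
  by (simp add: Sym_def transpose_add)

lemma Sym_scaleR [simp]: "p \<in> Sym \<Longrightarrow> c *\<^sub>R p \<in> Sym"
  by (simp add: Sym_def transpose_def vec_eq_iff)

lemma Sym_sum: "(\<And>i. i \<in> S \<Longrightarrow> f i \<in> Sym) \<Longrightarrow> sum f S \<in> Sym"
  by (auto simp add: Sym_def transpose_sum)

lemma Sym_congruence: "f \<in> Sym \<Longrightarrow> transpose a ** f ** a \<in> Sym"
  by (intro SymI) (simp add: matrix_transpose_mul SymD matrix_mul_assoc)

lemma Sym_mat_mult [simp]: "f \<in> Sym \<Longrightarrow> mat q ** f \<in> Sym"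
  by (intro SymI) (simp add: matrix_transpose_mul SymD mat_commute)

lemma quadratic_module_subset_Sym: "G \<subseteq> Sym \<Longrightarrow> quadratic_module G \<subseteq> Sym"
  unfolding quadratic_module_def by (auto intro!: Sym_sum Sym_congruence)

lemma congruence_generator_in_quadratic_module:
  assumes "g \<in> {mat 1} \<union> G"
  shows "transpose p ** g ** p \<in> quadratic_module G"
  unfolding quadratic_module_def mem_Collect_eq
  using assms by (intro exI[of _ 1] exI[of _ "\<lambda>_. g"] exI[of _ "\<lambda>_. p"]) auto

lemma square_in_quadratic_module:
  fixes p :: "('n::finite, 't::finite) matpoly"
  shows "transpose p ** p \<in> quadratic_module G"
  using congruence_generator_in_quadratic_module[of "mat 1" G p] by simp

text \<open>The outer factor is absorbed into the coefficients: each \<open>p i\<close> becomes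
  \<open>p i ** a\<close>.\<close>

lemma quadratic_module_congruence:
  assumes "f \<in> quadratic_module G"
  shows "transpose a ** f ** a \<in> quadratic_module G"
proof -
  obtain N :: nat and g p where f: "f = (\<Sum>i=1..N. transpose (p i) ** g i ** p i)"
      and N: "1 \<le> N" "\<forall>i\<in>{1..N}. g i \<in> {mat 1} \<union> G"
    using assms unfolding quadratic_module_def by blast
  have "transpose a ** f ** a = (\<Sum>i=1..N. transpose (p i ** a) ** g i ** (p i ** a))"
    by (simp add: f sum_matrix_mult matrix_mult_sum_right matrix_transpose_mul matrix_mul_assoc)
  then show ?thesis using N unfolding quadratic_module_def mem_Collect_eq
    by (intro exI[of _ N] exI[of _ g] exI[of _ "\<lambda>i. p i ** a"]) auto
qed

text \<open>Scalar matrices commute with everything, so congruence by \<open>mat q\<close> is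
  multiplication by the square of \<open>q\<close>.\<close>

lemma quadratic_module_scalar_square:
  assumes "f \<in> quadratic_module G"
  shows "mat (q * q) ** f \<in> quadratic_module G"
proof -
  have "transpose (mat q) ** f ** mat q = mat (q * q) ** f"
    by (simp add: vec_eq_iff mat_mult_component mult_mat_component mult_ac)
  then show ?thesis using quadratic_module_congruence[OF assms, of "mat q"] by simp
qed

subsection \<open>Positive forms\<close>

text \<open>States without the normalization: the forms that arise by multiplying with a square or
  by taking differences have arbitrary, possibly zero, value at \<open>mat 1\<close>. Bounds are
  therefore stated relative to that value.\<close>

definition positive_form ::
    "('n::finite, 't::finite) matpoly set \<Rightarrow> (('n, 't) matpoly \<Rightarrow> real) \<Rightarrow> bool" where
  "positive_form M \<phi> \<longleftrightarrow>
     (\<forall>p\<in>Sym. \<forall>q\<in>Sym. \<phi> (p + q) = \<phi> p + \<phi> q) \<and>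
     (\<forall>c::real. \<forall>p\<in>Sym. \<phi> (c *\<^sub>R p) = c * \<phi> p) \<and>
     (\<forall>p\<in>M. 0 \<le> \<phi> p)"

lemma is_state_iff: "is_state M L \<longleftrightarrow> positive_form M L \<and> L (mat 1) = 1"
  by (auto simp: is_state_def positive_form_def)

lemma positive_form_add: "positive_form M \<phi> \<Longrightarrow> p \<in> Sym \<Longrightarrow> q \<in> Sym \<Longrightarrow> \<phi> (p + q) = \<phi> p + \<phi> q"
  and positive_form_scaleR: "positive_form M \<phi> \<Longrightarrow> p \<in> Sym \<Longrightarrow> \<phi> (c *\<^sub>R p) = c * \<phi> p"
  and positive_form_nonneg: "positive_form M \<phi> \<Longrightarrow> p \<in> M \<Longrightarrow> 0 \<le> \<phi> p"
  by (simp_all add: positive_form_def)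

lemma positive_form_diff:
  assumes "positive_form M \<phi>" "p \<in> Sym" "q \<in> Sym"
  shows "\<phi> (p - q) = \<phi> p - \<phi> q"
  using positive_form_add[OF assms(1), of p "(-1) *\<^sub>R q"] positive_form_scaleR[OF assms(1,3), of "-1"]
    Sym_scaleR[OF assms(3), of "-1"] assms(2) by simp

lemma positive_form_sum:
  assumes "positive_form M \<phi>" "\<And>i. i \<in> S \<Longrightarrow> f i \<in> Sym"
  shows "\<phi> (sum f S) = (\<Sum>i\<in>S. \<phi> (f i))"
proof -
  have "\<phi> 0 = 0" using positive_form_scaleR[OF assms(1), of "mat 1" 0] by simp
  then show ?thesis using assms(2)
    by (induction S rule: infinite_finite_induct)
       (auto simp: positive_form_add[OF assms(1)] Sym_sum)
qed

lemma positive_form_divide: "positive_form M \<phi> \<Longrightarrow> 0 \<le> c \<Longrightarrow> positive_form M (\<lambda>f. \<phi> f / c)"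
  by (simp add: positive_form_def add_divide_distrib)

lemma positive_form_scalar_square:
  assumes "positive_form (quadratic_module G) \<phi>"
  shows "positive_form (quadratic_module G) (\<lambda>f. \<phi> (mat (q * q) ** f))"
proof -
  have "mat (q * q) ** (c *\<^sub>R f) = c *\<^sub>R (mat (q * q) ** f)" for c :: real and f :: "('a, 'b) matpoly"
    by (simp add: mat_single_mult[symmetric] matrix_mul_assoc mat_mult[symmetric] mult_ac)
  then show ?thesis
    using assms by (simp add: positive_form_def matrix_add_ldistrib quadratic_module_scalar_square)
qed

text \<open>\<open>N\<close> is fixed before the form, so one bound serves all positive forms at
  once, in particular those twisted by a scalar square.\<close>

lemma archimedean_bound:
  fixes a :: "('n::finite, 't::finite) matpoly"
  assumes "archimedean (quadratic_module G)"
  obtains N :: nat where "1 \<le> N"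
    "\<And>\<phi> :: _ \<Rightarrow> real. positive_form (quadratic_module G) \<phi> \<Longrightarrow> \<phi> (transpose a ** a) \<le> N * \<phi> (mat 1)"
proof -
  obtain N :: nat where N: "1 \<le> N" "mat (of_nat N) - transpose a ** a \<in> quadratic_module G"
    using assms unfolding archimedean_def by blast
  have "\<phi> (transpose a ** a) \<le> N * \<phi> (mat 1)" if "positive_form (quadratic_module G) \<phi>"
    for \<phi> :: "('n, 't) matpoly \<Rightarrow> real"
    using positive_form_nonneg[OF that N(2)] positive_form_diff[OF that, of "mat (of_nat N)" "transpose a ** a"]
      positive_form_scaleR[OF that, of "mat 1" N] Sym_congruence[of "mat 1" a]
    by (simp add: mat_of_nat)
  then show thesis using that N(1) by blast
qed

text \<open>Expand the square of \<open>f + mat 1\<close> as \<open>f^2 + 2 f + 1\<close>: the first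
  and last terms have nonnegative value, so twice the value of \<open>f\<close> is at most that of
  the whole square, which is bounded.\<close>

lemma archimedean_upper_bound:
  assumes "archimedean (quadratic_module G)" "f \<in> Sym"
  obtains K :: real where "0 \<le> K"
    "\<And>\<phi>. positive_form (quadratic_module G) \<phi> \<Longrightarrow> \<phi> f \<le> K * \<phi> (mat 1)"
proof -
  obtain N :: nat where N: "\<And>\<phi> :: _ \<Rightarrow> real. positive_form (quadratic_module G) \<phi> \<Longrightarrow>
      \<phi> (transpose (f + mat 1) ** (f + mat 1)) \<le> N * \<phi> (mat 1)"
    using archimedean_bound[OF assms(1)] by blast
  have "\<phi> f \<le> (N / 2) * \<phi> (mat 1)" if \<phi>: "positive_form (quadratic_module G) \<phi>" for \<phi>
  proof -
    let ?f2 = "transpose f ** f"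
    have f2: "?f2 \<in> Sym" using Sym_congruence[of "mat 1" f] by simp
    have "transpose (f + mat 1) ** (f + mat 1) = ?f2 + (2 *\<^sub>R f + mat 1)"
      using SymD[OF assms(2)]
      by (simp add: transpose_add matrix_add_ldistrib matrix_add_rdistrib scaleR_2)
    then have "\<phi> (transpose (f + mat 1) ** (f + mat 1)) = \<phi> ?f2 + 2 * \<phi> f + \<phi> (mat 1)"
      using f2 assms(2) by (simp add: positive_form_add[OF \<phi>] positive_form_scaleR[OF \<phi>])
    moreover have "0 \<le> \<phi> ?f2" "0 \<le> \<phi> (mat 1)"
      using positive_form_nonneg[OF \<phi>] square_in_quadratic_module[of f G]
        square_in_quadratic_module[of "mat 1" G] by simp_all
    ultimately show ?thesis using N[OF \<phi>] by simp
  qed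
  then show thesis using that[of "N / 2"] by simp
qed

text \<open>Each further factor \<open>p * p\<close> costs one factor \<open>N\<close>, by applying
  the hypothesis to the form twisted by the square of \<open>p ^ m\<close>.\<close>

lemma positive_form_power_bound:
  assumes \<phi>: "positive_form (quadratic_module G) \<phi>"
    and N: "\<And>\<psi>. positive_form (quadratic_module G) \<psi> \<Longrightarrow>
      \<psi> (mat (p * p)) \<le> N * \<psi> (mat 1)" and "0 \<le> (N::real)"
  shows "\<phi> (mat (p ^ m * p ^ m)) \<le> N ^ m * \<phi> (mat 1)"
proof (induction m)
  case (Suc m)
  have "\<phi> (mat (p ^ Suc m * p ^ Suc m)) \<le> N * \<phi> (mat (p ^ m * p ^ m))"
    using N[OF positive_form_scalar_square[OF \<phi>, of "p ^ m"]]
    by (simp add: mat_mult[symmetric] mult_ac)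
  also have "\<dots> \<le> N * (N ^ m * \<phi> (mat 1))"
    using Suc \<open>0 \<le> N\<close> by (rule mult_left_mono)
  finally show ?case by (simp add: mult_ac)
qed simp

text \<open>If \<open>a / N\<close> exceeded 1, its powers would outgrow \<open>C\<close>. Only
  exponents that are powers of two are at hand, since iterated Cauchy-Schwarz doubles the
  exponent.\<close>

lemma le_if_powers_le:
  fixes a N C :: real
  assumes "0 < N" "\<And>k::nat. a ^ (2 ^ k) \<le> C * N ^ (2 ^ k)"
  shows "a \<le> N"
proof (rule ccontr)
  assume "\<not> a \<le> N"
  then have gt: "1 < a / N" using assms(1) by simp
  then obtain k where k: "C < (a / N) ^ k" using real_arch_pow by blast
  have "k \<le> 2 ^ k" by simp
  then have "(a / N) ^ k \<le> (a / N) ^ (2 ^ k)" using gt by (intro power_increasing) auto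
  moreover have "(a / N) ^ (2 ^ k) \<le> C"
    using assms by (simp add: power_divide divide_le_eq)
  ultimately show False using k by simp
qed

text \<open>Although \<open>N - p\<^sup>2 \<in> M\<close> need not give \<open>(N - p\<^sup>2) M \<subseteq> M\<close>, positive forms do not see the
  difference: by Cauchy-Schwarz, \<open>\<psi>(q) = \<phi>(q f)\<close> satisfies
  \<open>(\<psi>(p\<^sup>2) / \<psi>(1)) ^ m \<le> \<psi>(p ^ (2 m)) / \<psi>(1)\<close> for powers \<open>m\<close> of two, while
  \<open>\<psi>(p ^ (2 m)) \<le> C N ^ m\<close> because \<open>f\<close> is bounded.\<close>

lemma positive_form_scalar_square_le:
  assumes arch: "archimedean (quadratic_module G)" and G: "G \<subseteq> Sym"
    and \<phi>: "positive_form (quadratic_module G) \<phi>"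
    and f: "f \<in> quadratic_module G" and "0 < (N::real)"
    and N: "\<And>\<psi>. positive_form (quadratic_module G) \<psi> \<Longrightarrow> \<psi> (mat (p * p)) \<le> N * \<psi> (mat 1)"
  shows "\<phi> (mat (p * p) ** f) \<le> N * \<phi> f"
proof -
  have fS: "f \<in> Sym" using f quadratic_module_subset_Sym[OF G] by blast
  obtain K where K: "0 \<le> K"
    "\<And>\<phi>. positive_form (quadratic_module G) \<phi> \<Longrightarrow> \<phi> f \<le> K * \<phi> (mat 1)"
    using archimedean_upper_bound[OF arch fS] by blast
  define \<psi> where "\<psi> q = \<phi> (mat q ** f)" for q
  have \<psi>_add: "\<psi> (q + r) = \<psi> q + \<psi> r" for q r
    using fS by (simp add: \<psi>_def mat_add matrix_add_rdistrib positive_form_add[OF \<phi>])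
  have \<psi>_scale: "\<psi> (Poly_Mapping.single 0 c * q) = c * \<psi> q" for c q
    using positive_form_scaleR[OF \<phi>, of "mat q ** f" c] fS
    by (simp add: \<psi>_def mat_mult mat_single_mult[symmetric] matrix_mul_assoc)
  have \<psi>_sq: "0 \<le> \<psi> (q * q)" for q
    unfolding \<psi>_def by (intro positive_form_nonneg[OF \<phi>] quadratic_module_scalar_square f)
  have CS: "(\<psi> q)\<^sup>2 \<le> \<psi> 1 * \<psi> (q * q)" for q
  proof (rule quadratic_form_discriminant)
    fix s t :: real
    let ?s = "Poly_Mapping.single 0 s :: 'a rpoly" and ?t = "Poly_Mapping.single 0 t :: 'a rpoly"
    \<comment> \<open>The expansion is bracketed so that additivity and scaling of \<psi> alone
      evaluate it.\<close>
    have "(?s + ?t * q) * (?s + ?t * q) =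
        ?s * (?s * 1) + (?s * (?t * q) + (?s * (?t * q) + ?t * (?t * (q * q))))"
      by (simp add: algebra_simps)
    then have "\<psi> ((?s + ?t * q) * (?s + ?t * q)) =
        s * (s * \<psi> 1) + (s * (t * \<psi> q) + (s * (t * \<psi> q) + t * (t * \<psi> (q * q))))"
      by (simp only: \<psi>_add \<psi>_scale)
    then show "0 \<le> s\<^sup>2 * \<psi> 1 + 2 * s * t * \<psi> q + t\<^sup>2 * \<psi> (q * q)"
      using \<psi>_sq[of "?s + ?t * q"] by (simp add: power2_eq_square algebra_simps)
  qed
  have bound: "\<psi> (p ^ m * p ^ m) \<le> K * \<phi> (mat 1) * N ^ m" for m
  proof -
    \<comment> \<open>The bound \<open>K\<close> on \<open>f\<close> is applied to \<phi> twisted by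
      the square of \<open>p ^ m\<close>, which removes \<open>f\<close>.\<close>
    have "\<psi> (p ^ m * p ^ m) \<le> K * \<phi> (mat (p ^ m * p ^ m))"
      using K(2)[OF positive_form_scalar_square[OF \<phi>, of "p ^ m"]] by (simp add: \<psi>_def)
    also have "\<dots> \<le> K * (N ^ m * \<phi> (mat 1))"
      using positive_form_power_bound[OF \<phi> N] K(1) \<open>0 < N\<close> by (simp add: mult_left_mono)
    finally show ?thesis by (simp add: mult_ac)
  qed
  have \<psi>1: "0 \<le> \<psi> 1" using \<psi>_sq[of 1] by simp
  have "\<psi> (p * p) \<le> N * \<psi> 1"
  proof (cases "\<psi> 1 = 0")
    case True
    then show ?thesis using CS[of "p * p"] by simp
  next
    case False
    then have pos: "0 < \<psi> 1" using \<psi>1 by simp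
    have iterated: "(\<psi> (p * p) / \<psi> 1) ^ (2 ^ k) \<le> \<psi> (p ^ (2 ^ k) * p ^ (2 ^ k)) / \<psi> 1" for k
    proof (induction k)
      case (Suc k)
      let ?u = "\<psi> (p ^ (2 ^ k) * p ^ (2 ^ k))"
      have "(\<psi> (p * p) / \<psi> 1) ^ (2 ^ Suc k) = ((\<psi> (p * p) / \<psi> 1) ^ (2 ^ k))\<^sup>2"
        by (simp add: power_mult[symmetric] mult.commute)
      also have "\<dots> \<le> (?u / \<psi> 1)\<^sup>2"
        using Suc \<psi>_sq[of p] pos by (intro power_mono) auto
      also have "\<dots> = ?u\<^sup>2 / \<psi> 1 / \<psi> 1" by (simp add: power2_eq_square)
      also have "\<dots> \<le> \<psi> (p ^ (2 ^ Suc k) * p ^ (2 ^ Suc k)) / \<psi> 1"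
        using CS[of "p ^ (2 ^ k) * p ^ (2 ^ k)"] pos
        by (intro divide_right_mono) (simp_all add: power_add[symmetric] mult_2 divide_le_eq mult_ac)
      finally show ?case .
    qed simp
    have "\<psi> (p * p) / \<psi> 1 \<le> N"
    proof (rule le_if_powers_le[OF \<open>0 < N\<close>])
      fix k
      have "\<psi> (p ^ (2 ^ k) * p ^ (2 ^ k)) / \<psi> 1 \<le> (K * \<phi> (mat 1) / \<psi> 1) * N ^ (2 ^ k)"
        using bound[of "2 ^ k"] pos by (simp add: divide_right_mono)
      then show "(\<psi> (p * p) / \<psi> 1) ^ (2 ^ k) \<le> (K * \<phi> (mat 1) / \<psi> 1) * N ^ (2 ^ k)"
        using iterated[of k] by (rule order_trans[rotated])
    qed
    then show ?thesis using pos by (simp add: divide_le_eq)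
  qed
  then show ?thesis by (simp add: \<psi>_def)
qed

subsection \<open>Pure states\<close>

text \<open>\<open>L\<close> is a convex combination of the normalizations of \<open>Q\<close> and
  \<open>R * L - Q\<close>, with weights \<open>c / R\<close> and \<open>(R - c) / R\<close>. Purity
  identifies the first of these states with \<open>L\<close>.\<close>

lemma pure_state_multiplicative_square:
  assumes arch: "archimedean (quadratic_module G)" and G: "G \<subseteq> Sym"
    and pure: "pure_state (quadratic_module G) L" and f: "f \<in> Sym"
  shows "L (mat (q * q) ** f) = L (mat (q * q)) * L f"
proof -
  let ?M = "quadratic_module G"
  have L: "positive_form ?M L" and L1: "L (mat 1) = 1"
    using pure by (auto simp: pure_state_def is_state_iff)
  obtain N :: nat where N: "1 \<le> N"
    "\<And>\<phi> :: _ \<Rightarrow> real. positive_form ?M \<phi> \<Longrightarrow> \<phi> (mat (q * q)) \<le> N * \<phi> (mat 1)"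
    using archimedean_bound[OF arch, of "mat q"] unfolding transpose_mat mat_mult[symmetric] by blast
  define c where "c = L (mat (q * q))"
  \<comment> \<open>The extra 1 makes \<open>c < R\<close> strict, so that \<open>R * L - Q\<close>
    can be normalized.\<close>
  define R where "R = real N + 1"
  define Q where "Q f = L (mat (q * q) ** f)" for f
  have Q: "positive_form ?M Q"
    unfolding Q_def by (rule positive_form_scalar_square[OF L])
  have Q1: "Q (mat 1) = c" by (simp add: Q_def c_def)
  have "mat 1 \<in> ?M" using square_in_quadratic_module[of "mat 1" G] by simp
  then have c0: "0 \<le> c" using positive_form_nonneg[OF Q] Q1 by force
  have cR: "c < R" using N(2)[OF L] by (simp add: R_def c_def L1)
  have "Q f = c * L f"
  \<comment> \<open>For \<open>c = 0\<close> normalizing \<open>Q\<close> is impossible, but the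
    upper bound for \<open>f\<close> and \<open>- f\<close>, being a multiple of
    \<open>Q (mat 1)\<close>, gives \<open>Q f = 0\<close>.\<close>
  proof (cases "c = 0")
    case True
    have le: "Q h \<le> 0" if "h \<in> Sym" for h
      using archimedean_upper_bound[OF arch that] Q Q1 True by (metis mult_zero_right)
    have "Q (- f) = - Q f" using positive_form_scaleR[OF Q f, of "-1"] by simp
    moreover have "- f \<in> Sym" using Sym_scaleR[OF f, of "-1"] by simp
    ultimately show ?thesis using le[OF f] le[of "- f"] True by simp
  next
    case False
    then have cpos: "0 < c" using c0 by simp
    have "positive_form ?M (\<lambda>f. R * L f - Q f)"
      unfolding positive_form_def
    proof (intro conjI ballI allI)
      fix h assume h: "h \<in> ?M"
      have "Q h \<le> N * L h"
        unfolding Q_def by (rule positive_form_scalar_square_le[OF arch G L h]) (use N in auto)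
      then show "0 \<le> R * L h - Q h"
        using positive_form_nonneg[OF L h] by (simp add: R_def distrib_right)
    qed (simp_all add: positive_form_add[OF L] positive_form_add[OF Q]
        positive_form_scaleR[OF L] positive_form_scaleR[OF Q] algebra_simps)
    then have state2: "is_state ?M (\<lambda>f. (R * L f - Q f) / (R - c))"
      using cR positive_form_divide[of ?M _ "R - c"] by (simp add: is_state_iff Q1 L1)
    have state1: "is_state ?M (\<lambda>f. Q f / c)"
      using cpos positive_form_divide[OF Q, of c] by (simp add: is_state_iff Q1)
    have u: "0 < (R - c) / R" "(R - c) / R < 1"
      using cR cpos by simp_all
    have "L p = (1 - (R - c) / R) * (Q p / c) + (R - c) / R * ((R * L p - Q p) / (R - c))" for p
      using cR cpos by (simp add: field_simps)
    then have "Q f / c = L f"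
      using pure state1 state2 u f unfolding pure_state_def by blast
    then show ?thesis using cpos by (simp add: field_simps)
  qed
  then show ?thesis by (simp add: Q_def c_def)
qed

text \<open>Polarization: the squares of \<open>q + 1\<close> and \<open>q\<close> differ by
  \<open>2 q + 1\<close>, so multiplicativity for squares passes to \<open>q\<close> itself.\<close>

lemma pure_state_multiplicative:
  assumes arch: "archimedean (quadratic_module G)" and G: "G \<subseteq> Sym"
    and pure: "pure_state (quadratic_module G) L" and f: "f \<in> Sym"
  shows "L (mat q ** f) = L (mat q) * L f"
proof -
  have L: "positive_form (quadratic_module G) L" and L1: "L (mat 1) = 1"
    using pure by (auto simp: pure_state_def is_state_iff)
  note square = pure_state_multiplicative_square[OF arch G pure]
  have polar: "L (mat ((q + 1) * (q + 1)) ** h) = L (mat (q * q) ** h) + 2 * L (mat q ** h) + L h"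
    if "h \<in> Sym" for h
  proof -
    have "(q + 1) * (q + 1) = q * q + (q + (q + 1))" by (simp add: algebra_simps)
    then have "mat ((q + 1) * (q + 1)) ** h = mat (q * q) ** h + (mat q ** h + (mat q ** h + h))"
      by (simp only: mat_add matrix_add_rdistrib matrix_mul_lid)
    then have "L (mat ((q + 1) * (q + 1)) ** h) =
        L (mat (q * q) ** h) + (L (mat q ** h) + (L (mat q ** h) + L h))"
      using that by (simp only: positive_form_add[OF L] Sym_add Sym_mat_mult)
    then show ?thesis by simp
  qed
  have "L (mat ((q + 1) * (q + 1))) = L (mat (q * q)) + 2 * L (mat q) + 1"
    using polar[of "mat 1"] by (simp add: L1)
  then show ?thesis
    using polar[OF f] square[OF f, of q] square[OF f, of "q + 1"] by (simp add: algebra_simps)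
qed

section \<open>Pure states as trace forms at a point\<close>

lemma pure_state_scalar_eval:
  fixes G :: "('n::finite, 't::finite) matpoly set"
  assumes arch: "archimedean (quadratic_module G)" and G: "G \<subseteq> Sym"
    and pure: "pure_state (quadratic_module G) L"
  obtains x where "\<And>q. L (mat q) = poly_eval q x"
proof -
  have L: "positive_form (quadratic_module G) L" and L1: "L (mat 1) = 1"
    using pure by (auto simp: pure_state_def is_state_iff)
  have "L (mat q) = poly_eval q (\<chi> i. L (mat (Poly_Mapping.single (Poly_Mapping.single i 1) 1)))" for q
  proof (rule ring_hom_eq_poly_eval)
    show "L (mat (p + q)) = L (mat p) + L (mat q)" for p q
      by (simp add: mat_add positive_form_add[OF L])
    show "L (mat (p * q)) = L (mat p) * L (mat q)" for p q
      using pure_state_multiplicative[OF arch G pure, of "mat q" p] by (simp add: mat_mult)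
    show "L (mat (Poly_Mapping.single 0 c)) = c" for c
      by (simp add: mat_single positive_form_scaleR[OF L] L1)
  qed
  then show thesis by (rule that)
qed

text \<open>On the diagonal this is twice the matrix unit. The sum over all ordered pairs then
  yields exactly \<open>2 f\<close>, without separating the case \<open>i = j\<close>.\<close>

definition sym_unit :: "'t::finite \<Rightarrow> 't \<Rightarrow> ('n::finite, 't) matpoly" where
  "sym_unit i j = (\<chi> a b. (if a = i \<and> b = j then 1 else 0) + (if a = j \<and> b = i then 1 else 0))"

lemma sym_unit_in_Sym: "sym_unit i j \<in> Sym"
  by (intro SymI) (simp add: sym_unit_def transpose_def vec_eq_iff add.commute conj_commute)

lemma Sym_expansion:
  assumes "f \<in> Sym"
  shows "2 *\<^sub>R f = (\<Sum>i\<in>UNIV. \<Sum>j\<in>UNIV. mat (f $ i $ j) ** sym_unit i j)"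
proof -
  have "f $ b $ a = f $ a $ b" for a b
    using arg_cong[OF SymD[OF assms], of "\<lambda>h. h $ a $ b"] by (simp add: transpose_def)
  moreover have "(\<Sum>i\<in>UNIV. \<Sum>j\<in>UNIV. g i j * ((if a = i \<and> b = j then 1 else 0) + (if a = j \<and> b = i then 1 else 0)))
      = g a b + g b a" for g :: "'b \<Rightarrow> 'b \<Rightarrow> 'a rpoly" and a b
  proof -
    have "(\<Sum>i\<in>UNIV. \<Sum>j\<in>UNIV. g i j * (if a = i \<and> b = j then 1 else 0)) =
        (\<Sum>i\<in>UNIV. if a = i then g i b else 0)"
      by (intro sum.cong refl) (simp add: if_distrib cong: if_cong)
    moreover have "(\<Sum>i\<in>UNIV. \<Sum>j\<in>UNIV. g i j * (if a = j \<and> b = i then 1 else 0)) =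
        (\<Sum>i\<in>UNIV. if b = i then g i a else 0)"
      by (intro sum.cong refl) (simp add: if_distrib cong: if_cong)
    ultimately show ?thesis by (simp add: distrib_left sum.distrib)
  qed
  ultimately show ?thesis
    by (simp add: vec_eq_iff mat_mult_component sym_unit_def scaleR_2)
qed

text \<open>The matrices \<open>sym_unit i j\<close> span \<open>Sym\<close> over the scalar
  polynomials, and scalars factor out of \<open>L\<close> as values at \<open>x\<close>. So
  \<open>L\<close> is determined by \<open>x\<close> and its values on these finitely many
  matrices.\<close>

lemma pure_state_eq_inner:
  fixes G :: "('n::finite, 't::finite) matpoly set"
  assumes arch: "archimedean (quadratic_module G)" and G: "G \<subseteq> Sym"
    and pure: "pure_state (quadratic_module G) L"
  obtains x B where "transpose B = B" "\<And>f. f \<in> Sym \<Longrightarrow> L f = mat_eval f x \<bullet> B"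
proof -
  have L: "positive_form (quadratic_module G) L"
    using pure by (auto simp: pure_state_def is_state_iff)
  obtain x where x: "\<And>q. L (mat q) = poly_eval q x"
    using pure_state_scalar_eval[OF arch G pure] by blast
  \<comment> \<open>Halving compensates for the factor 2 in \<open>Sym_expansion\<close>.\<close>
  define B :: "real ^ 't ^ 't" where "B = (\<chi> i j. L (sym_unit i j) / 2)"
  have "sym_unit i j = (sym_unit j i :: ('n, 't) matpoly)" for i j
    by (simp add: sym_unit_def vec_eq_iff add.commute)
  then have "transpose B = B" unfolding B_def transpose_def by simp
  moreover have "L f = mat_eval f x \<bullet> B" if f: "f \<in> Sym" for f
  proof -
    have "2 * L f = L (2 *\<^sub>R f)" using positive_form_scaleR[OF L f] by simp
    also have "\<dots> = (\<Sum>i\<in>UNIV. \<Sum>j\<in>UNIV. L (mat (f $ i $ j) ** sym_unit i j))"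
      by (simp add: Sym_expansion[OF f] positive_form_sum[OF L] Sym_sum sym_unit_in_Sym)
    also have "\<dots> = (\<Sum>i\<in>UNIV. \<Sum>j\<in>UNIV. poly_eval (f $ i $ j) x * L (sym_unit i j))"
      by (simp add: pure_state_multiplicative[OF arch G pure sym_unit_in_Sym] x)
    also have "\<dots> = 2 * (mat_eval f x \<bullet> B)"
      by (simp add: inner_vec_def mat_eval_def B_def sum_distrib_left)
    finally show ?thesis by simp
  qed
  ultimately show thesis by (rule that)
qed

section \<open>States concentrated at a point of the positivity locus\<close>

lemma mat_eval_add: "mat_eval (p + q) x = mat_eval p x + mat_eval q x"
  by (simp add: mat_eval_def vec_eq_iff poly_eval_add)

lemma mat_eval_scaleR: "mat_eval (c *\<^sub>R p) x = c *\<^sub>R mat_eval p x"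
  by (simp add: mat_eval_def vec_eq_iff poly_eval_scaleR)

lemma mat_eval_sum: "mat_eval (sum f S) x = (\<Sum>i\<in>S. mat_eval (f i) x)"
  by (simp add: mat_eval_def vec_eq_iff poly_eval_sum)

lemma mat_eval_mult: "mat_eval (p ** q) x = mat_eval p x ** mat_eval q x"
  by (simp add: mat_eval_def vec_eq_iff matrix_matrix_mult_def poly_eval_sum poly_eval_mult)

lemma mat_eval_transpose: "mat_eval (transpose p) x = transpose (mat_eval p x)"
  by (simp add: mat_eval_def vec_eq_iff transpose_def)

lemma mat_eval_mat_1: "mat_eval (mat 1) x = mat 1"
  by (simp add: mat_eval_def vec_eq_iff mat_def)

lemma psd_mat_eval:
  assumes "x \<in> psd_locus G" "f \<in> quadratic_module G"
  shows "psd (mat_eval f x)"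
proof -
  obtain N :: nat and g p where f: "f = (\<Sum>i=1..N. transpose (p i) ** g i ** p i)"
      and g: "\<forall>i\<in>{1..N}. g i \<in> {mat 1} \<union> G"
    using assms(2) unfolding quadratic_module_def by blast
  have "psd (mat_eval (g i) x)" if "i \<in> {1..N}" for i
    using g[rule_format, OF that] assms(1) by (auto simp: psd_locus_def mat_eval_mat_1 psd_mat_1)
  then show ?thesis
    by (auto simp: f mat_eval_sum mat_eval_mult mat_eval_transpose intro!: psd_sum psd_congruence)
qed

lemma is_state_inner:
  assumes "x \<in> psd_locus G" "psd C" "mat 1 \<bullet> C = 1"
  shows "is_state (quadratic_module G) (\<lambda>f. mat_eval f x \<bullet> C)"
  using assms
  by (simp add: is_state_def mat_eval_add mat_eval_scaleR inner_add_left mat_eval_mat_1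
      psd_inner_nonneg psd_mat_eval)

lemma inner_mat_1: "mat 1 \<bullet> (B :: real ^ 't::finite ^ 't) = (\<Sum>i\<in>UNIV. B $ i $ i)"
  by (simp add: inner_vec_def mat_def if_distrib[of "\<lambda>z. z * _"] cong: if_cong)

lemma inner_mat_1_outer: "mat 1 \<bullet> outer v v = v \<bullet> v"
  by (simp add: inner_outer)

lemma psd_diag_pos:
  assumes "psd B" "mat 1 \<bullet> B \<noteq> 0"
  obtains i where "0 < B $ i $ i"
proof (rule ccontr)
  assume "\<not> thesis"
  then have "\<not> 0 < B $ i $ i" for i using that by blast
  then have "B $ i $ i = 0" for i using psd_diag_nonneg[OF assms(1), of i] by (simp add: less_le)
  then show False using assms(2) by (simp add: inner_mat_1)
qed

text \<open>Testing the form on the congruences \<open>(w u\<^sup>T)\<^sup>T g (w u\<^sup>T)\<close>, whose values are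
  \<open>\<langle>g(x) w, w\<rangle> \<langle>B u, u\<rangle>\<close>, decouples positivity of \<open>B\<close> (take \<open>g = 1\<close>) from positivity
  of \<open>g(x)\<close>.\<close>

lemma positive_inner_form_psd:
  fixes G :: "('n::finite, 't::finite) matpoly set"
  assumes G: "G \<subseteq> Sym" and nonneg: "\<And>f. f \<in> quadratic_module G \<Longrightarrow> 0 \<le> mat_eval f x \<bullet> B"
    and sym: "transpose B = B" and trace: "mat 1 \<bullet> B = 1"
  shows "psd B" "x \<in> psd_locus G"
proof -
  have test: "0 \<le> ((mat_eval g x *v w) \<bullet> w) * ((B *v u) \<bullet> u)" if "g \<in> {mat 1} \<union> G" for g w u
  proof -
    \<comment> \<open>The real rank-one matrix as a matrix of constant polynomials.\<close>
    define P :: "('n, 't) matpoly" where "P = (\<chi> i j. Poly_Mapping.single 0 (outer w u $ i $ j))"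
    have P: "mat_eval P x = outer w u"
      by (simp add: P_def mat_eval_def vec_eq_iff poly_eval_single)
    have "0 \<le> mat_eval (transpose P ** g ** P) x \<bullet> B"
      by (intro nonneg congruence_generator_in_quadratic_module that)
    then show ?thesis
      by (simp add: mat_eval_mult mat_eval_transpose P congruence_outer inner_outer
          inner_commute[of "outer u u"])
  qed
  show psdB: "psd B"
    \<comment> \<open>Any unit vector makes the first factor of \<open>test\<close> equal to 1; the
      index is arbitrary.\<close>
    unfolding psd_def using test[of "mat 1" "axis undefined 1"] sym
    by (simp add: mat_eval_mat_1 inner_axis_axis)
  \<comment> \<open>Trace one yields a strictly positive value of the form of \<open>B\<close>,
    which can be cancelled in \<open>test\<close>.\<close>
  obtain i where "0 < B $ i $ i" using psd_diag_pos[OF psdB] trace by auto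
  then have i: "0 < (B *v axis i 1) \<bullet> axis i 1" by (simp add: matrix_entry_eq_inner)
  have "psd (mat_eval g x)" if "g \<in> G" for g
    unfolding psd_def
  proof (intro conjI allI)
    show "transpose (mat_eval g x) = mat_eval g x"
      using G that by (auto simp: mat_eval_transpose[symmetric] SymD)
    show "0 \<le> (mat_eval g x *v w) \<bullet> w" for w
      using test[of g w "axis i 1"] that i by (simp add: zero_le_mult_iff)
  qed
  then show "x \<in> psd_locus G" by (simp add: psd_locus_def)
qed

theorem theorem9:
  fixes G :: "('n::finite, 't::finite) matpoly set"
    and L :: "('n, 't) matpoly \<Rightarrow> real"
  assumes "G \<subseteq> Sym"
    and "archimedean (quadratic_module G)"
    and "pure_state (quadratic_module G) L"
  shows "\<exists>x\<in>psd_locus G. \<exists>v :: real ^ 't. norm v = 1 \<and>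
           (\<forall>p\<in>Sym. L p = (mat_eval p x *v v) \<bullet> v)"
proof -
  let ?M = "quadratic_module G"
  have L: "positive_form ?M L" and L1: "L (mat 1) = 1"
    using assms(3) by (auto simp: pure_state_def is_state_iff)
  obtain x B where sym: "transpose B = B" and LB: "\<And>f. f \<in> Sym \<Longrightarrow> L f = mat_eval f x \<bullet> B"
    using pure_state_eq_inner[OF assms(2,1,3)] by blast
  have trace: "mat 1 \<bullet> B = 1" using LB[of "mat 1"] L1 by (simp add: mat_eval_mat_1)
  have "0 \<le> mat_eval f x \<bullet> B" if "f \<in> ?M" for f
    using positive_form_nonneg[OF L that] LB quadratic_module_subset_Sym[OF assms(1)] that by auto
  note psdB = positive_inner_form_psd(1)[OF assms(1) this sym trace]
    and x = positive_inner_form_psd(2)[OF assms(1) this sym trace]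
  obtain i where i: "0 < B $ i $ i" using psd_diag_pos[OF psdB] trace by auto
  define b where "b = B *v axis i 1"
  define C where "C = B - (1 / B $ i $ i) *\<^sub>R outer b b"
  \<comment> \<open>The trace of the remainder is its weight in the convex combination; the rank-one
    piece carries the weight \<open>1 - \<tau>\<close>.\<close>
  define \<tau> where "\<tau> = mat 1 \<bullet> C"
  have psdC: "psd C" unfolding C_def b_def by (rule psd_deflate[OF psdB i])
  have B: "A \<bullet> B = (1 / B $ i $ i) * (A \<bullet> outer b b) + A \<bullet> C" for A
    by (simp add: C_def inner_diff_right)
  have "b $ i = B $ i $ i" by (simp add: b_def matrix_vector_mult_basis column_def)
  then have "b \<noteq> 0" using i by auto
  then have bb: "0 < b \<bullet> b" by simp
  have s: "(b \<bullet> b) / B $ i $ i = 1 - \<tau>"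
    using B[of "mat 1"] trace by (simp add: \<tau>_def inner_mat_1_outer)
  have \<tau>1: "\<tau> < 1" using s bb i by (metis diff_gt_0_iff_gt divide_pos_pos)
  have \<tau>0: "0 \<le> \<tau>" unfolding \<tau>_def by (rule psd_inner_nonneg[OF psd_mat_1 psdC])
  have inv: "1 / B $ i $ i = (1 - \<tau>) / (b \<bullet> b)" using s bb by (simp add: field_simps)
  define E where "E f = mat_eval f x \<bullet> ((1 / (b \<bullet> b)) *\<^sub>R outer b b)" for f
  have "L p = E p" if p: "p \<in> Sym" for p
  \<comment> \<open>A positive semidefinite matrix of trace zero vanishes, so in that case
    \<open>B\<close> already has rank one. Otherwise both pieces normalize to states at
    \<open>x\<close> and purity applies.\<close>
  proof (cases "\<tau> = 0")
    case True
    then have "C $ j $ j = 0" for j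
      using psd_diag_nonneg[OF psdC] by (simp add: \<tau>_def inner_mat_1 sum_nonneg_eq_0_iff)
    then have "C $ j $ k = 0" for j k using psd_diag_zero_imp_entry_zero(1)[OF psdC] by blast
    then have "C = 0" unfolding vec_eq_iff by simp
    then show ?thesis using LB[OF p] B[of "mat_eval p x"] inv True by (simp add: E_def)
  next
    case False
    define F where "F f = mat_eval f x \<bullet> ((1 / \<tau>) *\<^sub>R C)" for f
    have "is_state ?M E"
      unfolding E_def using bb
      by (intro is_state_inner x psd_scaleR psd_outer) (simp_all add: inner_mat_1_outer)
    moreover have "is_state ?M F"
      unfolding F_def using \<tau>0 False
      by (intro is_state_inner x psd_scaleR psdC) (simp_all add: \<tau>_def[symmetric])
    moreover have "L f = (1 - \<tau>) * E f + \<tau> * F f" if "f \<in> Sym" for f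
      using False LB[OF that] B[of "mat_eval f x"] inv by (simp add: E_def F_def)
    moreover have "0 < \<tau>" using \<tau>0 False by simp
    ultimately have "E p = L p"
      using assms(3) p \<tau>1 unfolding pure_state_def by blast
    then show ?thesis by simp
  qed
  \<comment> \<open>The factor \<open>1 / (b \<bullet> b)\<close> splits evenly between the two
    arguments, giving the unit vector.\<close>
  moreover have "E f = (mat_eval f x *v ((1 / norm b) *\<^sub>R b)) \<bullet> ((1 / norm b) *\<^sub>R b)" for f
    by (simp add: E_def inner_outer matrix_vector_mult_scaleR dot_square_norm power2_eq_square)
  moreover have "norm ((1 / norm b) *\<^sub>R b) = 1" using \<open>b \<noteq> 0\<close> by simp
  ultimately show ?thesis using x by metis
qed

end
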